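(* Let $C$ be a correlation matrix of rank $3$ whose orthogonality graph is (isomorphic to) the orthogonality graph of a minimal unextendible product basis in $\mathbb{C}^3\otimes\mathbb{C}^3$, i.e. one of size $5$. Then $C$ is not completely positive semidefinite (CPSD).
   Context: A correlation matrix is a positive semidefinite matrix with all diagonal entries equal to $1$. The orthogonality graph of an $N\times N$ correlation matrix $C=(c_{ij})$, i.e. of unit vectors $\{u_i\}_{i=1}^N$ with Gram matrix $C$, is the graph on $\{1,\dots,N\}$ with an edge between $i\ne j$ if and only if $c_{ij}=\langle u_i,u_j\rangle=0$. Unextendible product basis (UPB): sets of nonzero vectors $\{u_i\}_{i=1}^n\subseteq\mathbb{C}^{d_1}$, $\{v_i\}_{i=1}^n\subseteq\mathbb{C}^{d_2}$ form a UPB of size $n$ if the tensor products $u_i\otimes v_i$ are mutually orthogonal and there is no nonzero product vector $x\otimes y\in\mathbb{C}^{d_1}\otimes\mathbb{C}^{d_2}$ in the orthogonal complement of $\{u_i\otimes v_i\}_{i=1}^n$. The orthogonality graph of the UPB is the graph on $\{1,\dots,n\}$ with an edge between $i\neq j$ if and only if $\langle u_i,u_j\rangle=0$. The minimal size of a UPB in $\mathbb{C}^3\otimes\mathbb{C}^3$ is $5$. A symmetric $N\times N$ matrix $X$ is completely positive semidefinite (CPSD) if there exist positive semidefinite matrices $P_1,\dots,P_N\in M_k(\mathbb{C})$, for some $k\ge1$, such that $X_{ij}=\mathrm{Tr}(P_iP_j)$ for all $i,j$. *)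

theory Defs
  imports
    "Jordan_Normal_Form.Schur_Decomposition"
    "Jordan_Normal_Form.DL_Rank"
    "Graph_Theory.Digraph_Isomorphism"
begin

text \<open>
  Vectors and matrices are those of \<open>Jordan_Normal_Form\<close>; all indices run over \<open>{0..<n}\<close>
  instead of \<open>{1..n}\<close>. The inner product \<open>x \<bullet>c y\<close> is the sum of the \<open>x $ i * conjugate (y $ i)\<close>.
  Families \<open>u\<close> of vectors are functions on \<open>nat\<close> of which only the values at \<open>i < n\<close> matter.
\<close>

definition psd_mat :: "nat \<Rightarrow> complex mat \<Rightarrow> bool" where
  "psd_mat n A \<longleftrightarrow> A \<in> carrier_mat n n \<and> mat_adjoint A = A \<and>
     (\<forall>x \<in> carrier_vec n. Re ((A *\<^sub>v x) \<bullet>c x) \<ge> 0)"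

definition correlation_mat :: "nat \<Rightarrow> complex mat \<Rightarrow> bool" where
  "correlation_mat n C \<longleftrightarrow> psd_mat n C \<and> (\<forall>i<n. C $$ (i, i) = 1)"

definition mat_trace :: "complex mat \<Rightarrow> complex" where
  "mat_trace A = (\<Sum>i<dim_row A. A $$ (i, i))"

definition cpsd_mat :: "nat \<Rightarrow> complex mat \<Rightarrow> bool" where
  "cpsd_mat n X \<longleftrightarrow> X \<in> carrier_mat n n \<and> transpose_mat X = X \<and>
     (\<exists>k\<ge>1. \<exists>P :: nat \<Rightarrow> complex mat.
        (\<forall>i<n. psd_mat k (P i)) \<and>
        (\<forall>i<n. \<forall>j<n. X $$ (i, j) = mat_trace (P i * P j)))"

text \<open>
  The simple tensor, with respect to the lexicographically ordered product basis:
  the basis vector \<open>e\<^sub>a \<otimes> e\<^sub>b\<close> has index \<open>a * dim_vec y + b\<close>.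
\<close>

definition tensor_vec :: "complex vec \<Rightarrow> complex vec \<Rightarrow> complex vec" where
  "tensor_vec x y =
     vec (dim_vec x * dim_vec y) (\<lambda>k. x $ (k div dim_vec y) * y $ (k mod dim_vec y))"

definition upb :: "nat \<Rightarrow> nat \<Rightarrow> nat \<Rightarrow> (nat \<Rightarrow> complex vec) \<Rightarrow> (nat \<Rightarrow> complex vec) \<Rightarrow> bool" where
  "upb d1 d2 n u v \<longleftrightarrow>
     (\<forall>i<n. u i \<in> carrier_vec d1 \<and> u i \<noteq> 0\<^sub>v d1 \<and> v i \<in> carrier_vec d2 \<and> v i \<noteq> 0\<^sub>v d2) \<and>
     (\<forall>i<n. \<forall>j<n. i \<noteq> j \<longrightarrow> tensor_vec (u i) (v i) \<bullet>c tensor_vec (u j) (v j) = 0) \<and>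
     \<not> (\<exists>x \<in> carrier_vec d1. \<exists>y \<in> carrier_vec d2.
          tensor_vec x y \<noteq> 0\<^sub>v (d1 * d2) \<and>
          (\<forall>i<n. tensor_vec x y \<bullet>c tensor_vec (u i) (v i) = 0))"

text \<open>
  Simple graphs are modelled as loop-free symmetric digraphs, an edge between \<open>i\<close> and \<open>j\<close>
  being the two arcs \<open>(i, j)\<close> and \<open>(j, i)\<close>.
\<close>

definition mat_orth_graph :: "nat \<Rightarrow> complex mat \<Rightarrow> nat pair_pre_digraph" where
  "mat_orth_graph n C =
     \<lparr> pverts = {..<n},
       parcs = {(i, j). i < n \<and> j < n \<and> i \<noteq> j \<and> C $$ (i, j) = 0} \<rparr>"

text \<open>The orthogonality graph of a UPB is that of its first components only.\<close>

definition upb_orth_graph :: "nat \<Rightarrow> (nat \<Rightarrow> complex vec) \<Rightarrow> nat pair_pre_digraph" where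
  "upb_orth_graph n u =
     \<lparr> pverts = {..<n},
       parcs = {(i, j). i < n \<and> j < n \<and> i \<noteq> j \<and> u i \<bullet>c u j = 0} \<rparr>"

end

(*
  No nonzero vector is orthogonal to three of the u i: otherwise a vector orthogonal to the other
  two v j would complete it to a product vector extending the UPB. The same holds for the v i, and
  since u i and u j or v i and v j are orthogonal for all distinct i and j, the orthogonality graph
  of u is 2-regular on five vertices, hence a pentagon.

  Suppose C is the Gram matrix of positive semidefinite matrices P i. Orthogonality then means
  P i * P j = 0. If C had rank 3, a nonzero linear combination of only four of the P i would
  vanish. Multiplying it on both sides by suitable P e and P q kills all terms but
  one, so that all coefficients are 0.
*)
theory Submission
  imports Defs
begin

section \<open>Factorization of positive semidefinite matrices and products of trace zero\<close>

lemma psd_mat_hermitian: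
  assumes "psd_mat n A" "i < n" "j < n"
  shows "A $$ (j, i) = cnj (A $$ (i, j))"
proof -
  have A: "A \<in> carrier_mat n n" using assms(1) by (simp add: psd_mat_def)
  have "mat_adjoint A $$ (j, i) = cnj (A $$ (i, j))"
    using A assms(2,3) by (simp add: mat_adjoint_def mat_of_rows_def)
  then show ?thesis using assms(1) by (simp add: psd_mat_def)
qed

text \<open>
  Cholesky factorization by induction on Schur complements. If the pivot is 0 then so is its
  row, and division by 0 makes the same formulas valid in this case.
\<close>

lemma psd_mat_factor:
  assumes psd: "psd_mat n P"
  obtains B where "\<And>i j. i < n \<Longrightarrow> j < n \<Longrightarrow> P $$ (i, j) = (\<Sum>k<n. B i k * cnj (B j k))"
proof -
  have split: "(\<Sum>i<Suc m. \<Sum>j<Suc m. cnj (y i) * A i j * y j) =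
      (\<Sum>i<m. \<Sum>j<m. cnj (y i) * A i j * y j) + (\<Sum>i<m. cnj (y i) * A i m) * y m
      + cnj (y m) * (\<Sum>j<m. A m j * y j) + cnj (y m) * A m m * y m"
    for m and y :: "nat \<Rightarrow> complex" and A
    by (simp add: sum.distrib sum_distrib_left sum_distrib_right mult.assoc)
  \<comment> \<open>The induction runs over plain functions, so that passing to the Schur complement
    only shrinks the index range.\<close>
  have factor: "\<exists>B. \<forall>i<m. \<forall>j<m. A i j = (\<Sum>k<m. B i k * cnj (B j k))"
    if "\<And>i j. i < m \<Longrightarrow> j < m \<Longrightarrow> A j i = cnj (A i j)"
      and "\<And>x. 0 \<le> Re (\<Sum>i<m. \<Sum>j<m. cnj (x i) * A i j * x j)"
    for m and A :: "nat \<Rightarrow> nat \<Rightarrow> complex"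
    using that
  proof (induction m arbitrary: A)
    case 0
    then show ?case by simp
  next
    case (Suc n A)
    note herm = Suc.prems(1) and pos = Suc.prems(2)
    define d where "d = Re (A n n)"
    have "Im (A n n) = 0" using herm[of n n] by (simp add: complex_eq_iff)
    then have d: "A n n = of_real d" by (simp add: d_def complex_eq_iff)
    have "d \<ge> 0" using pos[of "\<lambda>i. of_bool (i = n)"] by (simp add: split d_def)
    have col: "A i n = cnj (A n i)" if "i \<le> n" for i using herm[of n i] that by simp
    have row0: "A n j = 0" if "d = 0" "j < n" for j
    proof (rule ccontr)
      assume nz: "A n j \<noteq> 0"
      define c where "c = (cmod (A n j))\<^sup>2"
      have c: "A n j * cnj (A n j) = of_real c" "c > 0"
        using nz by (simp_all add: c_def flip: complex_norm_square)
      \<comment> \<open>The form at \<open>y\<close> will equal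
        \<open>Re (A j j) - 2 * t * c\<close>, because the pivot is 0. This \<open>t\<close> makes
        it -1, against positivity.\<close>
      define t where "t = (Re (A j j) + 1) / (2 * c)"
      define y where "y = (\<lambda>i. if i = n then - of_real t * A n j else of_bool (i = j))"
      have inner: "(\<Sum>i<n. \<Sum>l<n. cnj (y i) * A i l * y l) = A j j"
        "(\<Sum>i<n. cnj (y i) * A i n) = A j n" "(\<Sum>l<n. A n l * y l) = A n j"
      proof -
        have "(\<Sum>i<n. \<Sum>l<n. cnj (y i) * A i l * y l)
            = (\<Sum>i<n. \<Sum>l<n. if l = j then if i = j then A j j else 0 else 0)"
          by (intro sum.cong refl) (auto simp: y_def)
        then show "(\<Sum>i<n. \<Sum>l<n. cnj (y i) * A i l * y l) = A j j" using that(2) by simp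
        have "(\<Sum>i<n. cnj (y i) * A i n) = (\<Sum>i<n. if i = j then A j n else 0)"
          by (intro sum.cong refl) (auto simp: y_def)
        then show "(\<Sum>i<n. cnj (y i) * A i n) = A j n" using that(2) by simp
        have "(\<Sum>l<n. A n l * y l) = (\<Sum>l<n. if l = j then A n j else 0)"
          by (intro sum.cong refl) (auto simp: y_def)
        then show "(\<Sum>l<n. A n l * y l) = A n j" using that(2) by simp
      qed
      have Ajn: "A j n = cnj (A n j)" "A n n = 0" using that d col[of j] by simp_all
      have yn: "y n = - of_real t * A n j" by (simp add: y_def)
      have "(\<Sum>i<Suc n. \<Sum>l<Suc n. cnj (y i) * A i l * y l)
          = A j j + cnj (A n j) * (- of_real t * A n j) + cnj (- of_real t * A n j) * A n j"
        unfolding split inner Ajn yn by simp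
      also have "\<dots> = A j j - 2 * of_real t * (A n j * cnj (A n j))" by (simp add: algebra_simps)
      also have "\<dots> = A j j - of_real (2 * t * c)" unfolding c(1) by simp
      finally have eq: "(\<Sum>i<Suc n. \<Sum>l<Suc n. cnj (y i) * A i l * y l) = A j j - of_real (2 * t * c)" .
      have "0 \<le> Re (A j j) - 2 * t * c" using pos[of y] unfolding eq by simp
      then show False using c(2) by (simp add: t_def)
    qed
    define A' where "A' = (\<lambda>i j. A i j - A i n * A n j / of_real d)"
    have "\<exists>B. \<forall>i<n. \<forall>j<n. A' i j = (\<Sum>k<n. B i k * cnj (B j k))"
    proof (rule Suc.IH)
      show "A' j i = cnj (A' i j)" if "i < n" "j < n" for i j
        using herm[of i j] col[of i] col[of j] that by (simp add: A'_def mult.commute)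
      show "0 \<le> Re (\<Sum>i<n. \<Sum>j<n. cnj (x i) * A' i j * x j)" for x
      proof -
        define s where "s = (\<Sum>j<n. A n j * x j)"
        \<comment> \<open>Completing the square: this last coordinate makes the form of
          \<open>A\<close> at \<open>y\<close> equal the form of the Schur complement at
          \<open>x\<close>. For \<open>d = 0\<close> it is 0 by division by 0, and the identity
          persists.\<close>
        define y where "y = x(n := - s / of_real d)"
        have s': "(\<Sum>i<n. cnj (x i) * A i n) = cnj s"
          using col by (simp add: s_def mult.commute)
        have inner: "(\<Sum>i<n. \<Sum>l<n. cnj (y i) * A i l * y l) = (\<Sum>i<n. \<Sum>l<n. cnj (x i) * A i l * x l)"
          "(\<Sum>i<n. cnj (y i) * A i n) = cnj s" "(\<Sum>l<n. A n l * y l) = s"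
          using s' by (simp_all add: y_def s_def)
        have "(\<Sum>i<n. \<Sum>j<n. cnj (x i) * A' i j * x j)
            = (\<Sum>i<n. \<Sum>j<n. cnj (x i) * A i j * x j - (cnj (x i) * A i n) * (A n j * x j) / of_real d)"
          by (simp add: A'_def algebra_simps)
        also have "\<dots> = (\<Sum>i<n. \<Sum>j<n. cnj (x i) * A i j * x j) - cnj s * s / of_real d"
          by (simp only: sum_subtractf sum_divide_distrib[symmetric] sum_product[symmetric] s' s_def)
        also have "\<dots> = (\<Sum>i<Suc n. \<Sum>j<Suc n. cnj (y i) * A i j * y j)"
        proof -
          have yn: "y n = - s / of_real d" "cnj (y n) = - cnj s / of_real d" by (simp_all add: y_def)
          show ?thesis
            unfolding split inner yn d by (cases "d = 0") simp_all
        qed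
        finally show ?thesis using pos[of y] by (simp only:)
      qed
    qed
    then obtain B where B: "A' i j = (\<Sum>k<n. B i k * cnj (B j k))" if "i < n" "j < n" for i j
      by blast
    \<comment> \<open>The factor of the Schur complement is bordered by the column
      \<open>A i n / sqrt d\<close>, whose outer square is exactly what \<open>A'\<close> subtracts
      from \<open>A\<close>. The rest of row \<open>n\<close> is 0.\<close>
    define B' where "B' = (\<lambda>i k. if k = n then A i n / of_real (sqrt d) else if i = n then 0 else B i k)"
    have last: "B' i n * cnj (B' j n) = A i n * A n j / of_real d" if "i \<le> n" "j \<le> n" for i j
    proof -
      have "complex_of_real (sqrt d) * complex_of_real (sqrt d) = of_real d"
        using \<open>d \<ge> 0\<close> by (metis of_real_mult real_sqrt_mult_self abs_of_nonneg)
      then show ?thesis using col[OF that(2)] by (simp add: B'_def)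
    qed
    have "A i j = (\<Sum>k<Suc n. B' i k * cnj (B' j k))" if "i < Suc n" "j < Suc n" for i j
    proof (cases "i < n \<and> j < n")
      case True
      then have "(\<Sum>k<n. B' i k * cnj (B' j k)) = A' i j" using B by (simp add: B'_def)
      then show ?thesis using last[of i j] True by (simp add: A'_def)
    next
      case False
      then have "i = n \<or> j = n" using that by auto
      then have "(\<Sum>k<n. B' i k * cnj (B' j k)) = 0" by (auto simp: B'_def)
      \<comment> \<open>The Schur complement vanishes on the last row and column. For a zero pivot
        the right side is 0, and \<open>row0\<close> is what makes the left side 0 too.\<close>
      moreover have "A i j = A i n * A n j / of_real d"
      proof (cases "d = 0")
        case True
        have zero: "A n l = 0" if "l \<le> n" for l
          using row0[OF True, of l] d True that by (cases "l = n") auto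
        from \<open>i = n \<or> j = n\<close> have "A i j = 0"
        proof
          assume "j = n"
          then have "A i j = cnj (A n i)" using col[of i] that by simp
          then show ?thesis using zero that by simp
        qed (use zero that in simp)
        then show ?thesis using True by simp
      next
        case False
        then show ?thesis using \<open>i = n \<or> j = n\<close> d by auto
      qed
      ultimately show ?thesis using last[of i j] that by simp
    qed
    then show ?case by blast
  qed
  have "\<exists>B. \<forall>i<n. \<forall>j<n. P $$ (i, j) = (\<Sum>k<n. B i k * cnj (B j k))"
  proof (rule factor)
    show "0 \<le> Re (\<Sum>i<n. \<Sum>j<n. cnj (x i) * P $$ (i, j) * x j)" for x
    proof -
      have P: "P \<in> carrier_mat n n" using psd by (simp add: psd_mat_def)
      then have "(P *\<^sub>v vec n x) \<bullet>c vec n x = (\<Sum>i<n. \<Sum>j<n. cnj (x i) * P $$ (i, j) * x j)"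
        by (auto simp: scalar_prod_def lessThan_atLeast0 sum_distrib_left sum_distrib_right
            mult_ac intro!: sum.cong)
      moreover have "0 \<le> Re ((P *\<^sub>v vec n x) \<bullet>c vec n x)" using psd by (simp add: psd_mat_def)
      ultimately show ?thesis by simp
    qed
  qed (rule psd_mat_hermitian[OF psd])
  then show thesis using that by blast
qed

lemma mat_trace_mult:
  assumes "A \<in> carrier_mat n m" "B \<in> carrier_mat m n"
  shows "mat_trace (A * B) = (\<Sum>i<n. \<Sum>j<m. A $$ (i, j) * B $$ (j, i))"
  using assms by (auto simp: mat_trace_def scalar_prod_def lessThan_atLeast0 intro!: sum.cong)

text \<open>Write \<open>P\<close> as B B* and \<open>Q\<close> as D D*, and let G = B* D. Then the
  trace of \<open>P * Q\<close> is the squared Frobenius norm of G, while \<open>P * Q\<close>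
  itself is B G D*. So trace zero forces G = 0 and hence \<open>P * Q = 0\<close>.\<close>

lemma psd_mat_mult_eq_0:
  assumes P: "psd_mat n P" and Q: "psd_mat n Q" and 0: "mat_trace (P * Q) = 0"
  shows "P * Q = 0\<^sub>m n n"
proof -
  have carrier: "P \<in> carrier_mat n n" "Q \<in> carrier_mat n n" using P Q by (simp_all add: psd_mat_def)
  obtain B where B: "\<And>i j. i < n \<Longrightarrow> j < n \<Longrightarrow> P $$ (i, j) = (\<Sum>k<n. B i k * cnj (B j k))"
    using psd_mat_factor[OF P] by blast
  obtain D where D: "\<And>i j. i < n \<Longrightarrow> j < n \<Longrightarrow> Q $$ (i, j) = (\<Sum>l<n. D i l * cnj (D j l))"
    using psd_mat_factor[OF Q] by blast
  define G where "G k l = (\<Sum>m<n. cnj (B m k) * D m l)" for k l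
  have entry: "(\<Sum>m<n. P $$ (i, m) * Q $$ (m, j)) = (\<Sum>k<n. \<Sum>l<n. B i k * cnj (D j l) * G k l)"
    if "i < n" "j < n" for i j
  proof -
    have "(\<Sum>m<n. P $$ (i, m) * Q $$ (m, j))
        = (\<Sum>m<n. \<Sum>k<n. \<Sum>l<n. B i k * cnj (D j l) * (cnj (B m k) * D m l))"
      using that by (intro sum.cong refl) (simp add: B D sum_product mult_ac)
    also have "\<dots> = (\<Sum>k<n. \<Sum>m<n. \<Sum>l<n. B i k * cnj (D j l) * (cnj (B m k) * D m l))"
      by (rule sum.swap)
    also have "\<dots> = (\<Sum>k<n. \<Sum>l<n. \<Sum>m<n. B i k * cnj (D j l) * (cnj (B m k) * D m l))"
      by (rule sum.cong[OF refl], rule sum.swap)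
    also have "\<dots> = (\<Sum>k<n. \<Sum>l<n. B i k * cnj (D j l) * G k l)"
      by (simp add: G_def sum_distrib_left)
    finally show ?thesis .
  qed
  have "mat_trace (P * Q) = (\<Sum>i<n. \<Sum>k<n. \<Sum>l<n. B i k * cnj (D i l) * G k l)"
    using carrier by (simp add: mat_trace_mult[of _ n n] entry)
  also have "\<dots> = (\<Sum>k<n. \<Sum>i<n. \<Sum>l<n. B i k * cnj (D i l) * G k l)"
    by (rule sum.swap)
  also have "\<dots> = (\<Sum>k<n. \<Sum>l<n. \<Sum>i<n. B i k * cnj (D i l) * G k l)"
    by (rule sum.cong[OF refl], rule sum.swap)
  also have "\<dots> = (\<Sum>k<n. \<Sum>l<n. cnj (G k l) * G k l)"
    by (simp add: G_def sum_distrib_right)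
  also have "\<dots> = of_real (\<Sum>k<n. \<Sum>l<n. (cmod (G k l))\<^sup>2)"
    unfolding of_real_sum complex_norm_square by (simp only: mult.commute)
  finally have "(\<Sum>k<n. \<Sum>l<n. (cmod (G k l))\<^sup>2) = 0" using 0 by (metis of_real_eq_0_iff)
  then have "G k l = 0" if "k < n" "l < n" for k l
    using that by (simp add: sum_nonneg_eq_0_iff sum_nonneg)
  then show ?thesis
    using carrier entry by (intro eq_matI) (simp_all add: scalar_prod_def lessThan_atLeast0)
qed

section \<open>Linear relations among positive semidefinite matrices\<close>

text \<open>Since the \<open>P j\<close> are Hermitian, the squared Frobenius norm of the
  combination Q is the sum of \<open>cnj (a j)\<close> times the trace of \<open>P j * Q\<close>.
  The kernel equation for \<open>j\<close> enters with weight \<open>cnj (a j)\<close>, so it may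
  fail wherever \<open>a j = 0\<close>.\<close>

lemma gram_kernel_lincomb:
  fixes P :: "nat \<Rightarrow> complex mat"
  assumes psd: "\<And>i. i < n \<Longrightarrow> psd_mat k (P i)"
    and ker: "\<And>j. j < n \<Longrightarrow> a j = 0 \<or> (\<Sum>i<n. a i * mat_trace (P j * P i)) = 0"
    and rs: "r < k" "s < k"
  shows "(\<Sum>i<n. a i * P i $$ (r, s)) = 0"
proof -
  define Q where "Q r s = (\<Sum>i<n. a i * P i $$ (r, s))" for r s
  have P: "P i \<in> carrier_mat k k" if "i < n" for i using psd[OF that] by (simp add: psd_mat_def)
  have herm: "cnj (P i $$ (r, s)) = P i $$ (s, r)" if "i < n" "r < k" "s < k" for i r s
    by (rule psd_mat_hermitian[OF psd[OF that(1)] that(2,3), symmetric])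
  have tr: "(\<Sum>i<n. a i * mat_trace (P j * P i)) = (\<Sum>s<k. \<Sum>r<k. P j $$ (s, r) * Q r s)" if j: "j < n" for j
  proof -
    have "(\<Sum>i<n. a i * mat_trace (P j * P i)) = (\<Sum>i<n. \<Sum>s<k. \<Sum>r<k. P j $$ (s, r) * (a i * P i $$ (r, s)))"
      using P[OF j] P by (intro sum.cong refl) (simp add: mat_trace_mult[of _ k k] sum_distrib_left mult.left_commute)
    also have "\<dots> = (\<Sum>s<k. \<Sum>i<n. \<Sum>r<k. P j $$ (s, r) * (a i * P i $$ (r, s)))"
      by (rule sum.swap)
    also have "\<dots> = (\<Sum>s<k. \<Sum>r<k. \<Sum>i<n. P j $$ (s, r) * (a i * P i $$ (r, s)))"
      by (rule sum.cong[OF refl], rule sum.swap)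
    finally show ?thesis by (simp add: Q_def sum_distrib_left)
  qed
  have "of_real (\<Sum>s<k. \<Sum>r<k. (cmod (Q r s))\<^sup>2) = (\<Sum>s<k. \<Sum>r<k. cnj (Q r s) * Q r s)"
    unfolding of_real_sum complex_norm_square by (simp only: mult.commute)
  also have "\<dots> = (\<Sum>s<k. \<Sum>r<k. \<Sum>j<n. cnj (a j) * (P j $$ (s, r) * Q r s))"
  proof (intro sum.cong refl)
    fix s r assume "s \<in> {..<k}" "r \<in> {..<k}"
    then have "cnj (Q r s) = (\<Sum>j<n. cnj (a j) * P j $$ (s, r))"
      by (simp add: Q_def herm)
    then show "cnj (Q r s) * Q r s = (\<Sum>j<n. cnj (a j) * (P j $$ (s, r) * Q r s))"
      by (simp only: sum_distrib_right mult.assoc)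
  qed
  also have "\<dots> = (\<Sum>s<k. \<Sum>j<n. \<Sum>r<k. cnj (a j) * (P j $$ (s, r) * Q r s))"
    by (rule sum.cong[OF refl], rule sum.swap)
  also have "\<dots> = (\<Sum>j<n. \<Sum>s<k. \<Sum>r<k. cnj (a j) * (P j $$ (s, r) * Q r s))"
    by (rule sum.swap)
  also have "\<dots> = (\<Sum>j<n. cnj (a j) * (\<Sum>s<k. \<Sum>r<k. P j $$ (s, r) * Q r s))"
    by (simp only: sum_distrib_left)
  also have "\<dots> = 0"
  proof (rule sum.neutral, rule ballI)
    fix j assume "j \<in> {..<n}"
    then have "j < n" by simp
    from ker[OF this] tr[OF this] show "cnj (a j) * (\<Sum>s<k. \<Sum>r<k. P j $$ (s, r) * Q r s) = 0" by auto
  qed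
  finally have "(\<Sum>s<k. \<Sum>r<k. (cmod (Q r s))\<^sup>2) = 0" by (metis of_real_eq_0_iff)
  then have "Q r s = 0" using rs by (simp add: sum_nonneg_eq_0_iff sum_nonneg)
  then show ?thesis by (simp add: Q_def)
qed

text \<open>Multiply the relation by \<open>P e\<close> on the left and \<open>P q\<close> on the
  right. By \<open>psd_mat_mult_eq_0\<close> each term other than \<open>e\<close> dies, leaving
  \<open>a e\<close> times \<open>P e * (P e * P q)\<close>. If \<open>a e\<close> were nonzero,
  this product would vanish, and then so would \<open>P e * P q\<close>, as \<open>P e\<close> is
  Hermitian; but its trace is nonzero.\<close>

lemma lincomb_coeff_eq_0:
  fixes P :: "nat \<Rightarrow> complex mat"
  assumes psd: "\<And>i. i < n \<Longrightarrow> psd_mat k (P i)"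
    and 0: "\<And>r s. r < k \<Longrightarrow> s < k \<Longrightarrow> (\<Sum>i<n. a i * P i $$ (r, s)) = 0"
    and e: "e < n" "q < n" "mat_trace (P e * P q) \<noteq> 0"
    and others: "\<And>i. i < n \<Longrightarrow> i \<noteq> e \<Longrightarrow>
      a i = 0 \<or> mat_trace (P e * P i) = 0 \<or> mat_trace (P i * P q) = 0"
  shows "a e = 0"
proof (rule ccontr)
  assume ae: "a e \<noteq> 0"
  have P: "P i \<in> carrier_mat k k" if "i < n" for i using psd[OF that] by (simp add: psd_mat_def)
  have herm: "cnj (P i $$ (r, s)) = P i $$ (s, r)" if "i < n" "r < k" "s < k" for i r s
    by (rule psd_mat_hermitian[OF psd[OF that(1)] that(2,3), symmetric])
  have mult_0: "P i * P j = 0\<^sub>m k k" if "i < n" "j < n" "mat_trace (P i * P j) = 0" for i j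
    by (rule psd_mat_mult_eq_0[OF psd[OF that(1)] psd[OF that(2)] that(3)])
  have prod: "(P e * (P i * P q)) $$ (r, c) = (\<Sum>s<k. \<Sum>t<k. P e $$ (r, s) * P q $$ (t, c) * P i $$ (s, t))"
    if "i < n" "r < k" "c < k" for i r c
    using that P[OF e(1)] P[OF e(2)] P[OF that(1)]
    by (simp add: scalar_prod_def lessThan_atLeast0 sum_distrib_left mult_ac)
  have EEq: "(P e * (P e * P q)) $$ (r, c) = 0" if rc: "r < k" "c < k" for r c
  proof -
    have "a e * (P e * (P e * P q)) $$ (r, c) = (\<Sum>i\<in>{e}. a i * (P e * (P i * P q)) $$ (r, c))" by simp
    also have "\<dots> = (\<Sum>i<n. a i * (P e * (P i * P q)) $$ (r, c))"
    proof (rule sum.mono_neutral_left)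
      show "\<forall>i\<in>{..<n} - {e}. a i * (P e * (P i * P q)) $$ (r, c) = 0"
      proof
        fix i assume "i \<in> {..<n} - {e}"
        then have i: "i < n" "i \<noteq> e" by auto
        have "P e * (P i * P q) = P e * P i * P q"
          using P i e by (simp add: assoc_mult_mat[of _ k k _ k _ k])
        with others[OF i] mult_0 i e have "a i = 0 \<or> P e * (P i * P q) = 0\<^sub>m k k"
          using P[OF e(1)] P[OF e(2)] by (metis left_mult_zero_mat right_mult_zero_mat)
        then show "a i * (P e * (P i * P q)) $$ (r, c) = 0" using rc by auto
      qed
    qed (use e in auto)
    also have "\<dots> = (\<Sum>i<n. \<Sum>s<k. \<Sum>t<k. P e $$ (r, s) * P q $$ (t, c) * (a i * P i $$ (s, t)))"
      using rc by (intro sum.cong refl) (simp add: prod sum_distrib_left mult.left_commute)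
    also have "\<dots> = (\<Sum>s<k. \<Sum>i<n. \<Sum>t<k. P e $$ (r, s) * P q $$ (t, c) * (a i * P i $$ (s, t)))"
      by (rule sum.swap)
    also have "\<dots> = (\<Sum>s<k. \<Sum>t<k. \<Sum>i<n. P e $$ (r, s) * P q $$ (t, c) * (a i * P i $$ (s, t)))"
      by (rule sum.cong[OF refl], rule sum.swap)
    also have "\<dots> = 0" by (simp add: 0 flip: sum_distrib_left)
    finally show ?thesis using ae by simp
  qed
  define M where "M = P e * P q"
  have M: "M \<in> carrier_mat k k" unfolding M_def by (rule mult_carrier_mat[OF P[OF e(1)] P[OF e(2)]])
  \<comment> \<open>Moving \<open>P e\<close> across the inner product turns the squared norm of
    column \<open>c\<close> of \<open>M\<close> into the pairing of column \<open>c\<close> of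
    \<open>P q\<close> with that of \<open>P e * M\<close>, which is 0 by
    \<open>EEq\<close>.\<close>
  have "M $$ (r, c) = 0" if rc: "r < k" "c < k" for r c
  proof -
    have "of_real (\<Sum>s<k. (cmod (M $$ (s, c)))\<^sup>2) = (\<Sum>s<k. cnj (M $$ (s, c)) * M $$ (s, c))"
      unfolding of_real_sum complex_norm_square by (simp only: mult.commute)
    also have "\<dots> = (\<Sum>s<k. \<Sum>t<k. cnj (P q $$ (t, c)) * (P e $$ (t, s) * M $$ (s, c)))"
    proof (rule sum.cong[OF refl])
      fix s assume "s \<in> {..<k}"
      then have "cnj (M $$ (s, c)) = (\<Sum>t<k. cnj (P q $$ (t, c)) * P e $$ (t, s))"
        using P[OF e(1)] P[OF e(2)] rc e(1)
        by (simp add: M_def scalar_prod_def lessThan_atLeast0 mult.commute herm)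
      then show "cnj (M $$ (s, c)) * M $$ (s, c) = (\<Sum>t<k. cnj (P q $$ (t, c)) * (P e $$ (t, s) * M $$ (s, c)))"
        by (simp only: sum_distrib_right mult.assoc)
    qed
    also have "\<dots> = (\<Sum>t<k. \<Sum>s<k. cnj (P q $$ (t, c)) * (P e $$ (t, s) * M $$ (s, c)))"
      by (rule sum.swap)
    also have "\<dots> = (\<Sum>t<k. cnj (P q $$ (t, c)) * (P e * M) $$ (t, c))"
      using P[OF e(1)] M rc by (simp add: scalar_prod_def lessThan_atLeast0 sum_distrib_left)
    also have "\<dots> = 0" using EEq rc by (simp add: M_def)
    finally have "(\<Sum>s<k. (cmod (M $$ (s, c)))\<^sup>2) = 0" by (metis of_real_eq_0_iff)
    then show ?thesis using rc by (simp add: sum_nonneg_eq_0_iff)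
  qed
  then have "mat_trace M = 0" using M by (simp add: mat_trace_def)
  then show False using e(3) by (simp add: M_def)
qed

section \<open>Rank 3 and the pentagon obstruction\<close>

text \<open>The kernel of \<open>C\<close> has dimension at least 2, so it meets the hyperplane
  \<open>a $ z = 0\<close> nontrivially. Leaving out the equation of row \<open>z\<close> gives a
  square system, so a determinant argument suffices, and it is the form that
  \<open>gram_kernel_lincomb\<close> accepts.\<close>

lemma ex_almost_kernel_vec:
  fixes C :: "complex mat"
  assumes C: "C \<in> carrier_mat n n" and rank: "vec_space.rank n C + 1 < n" and z: "z < n"
  obtains a where "a \<in> carrier_vec n" "a \<noteq> 0\<^sub>v n" "a $ z = 0"
    "\<And>j. j < n \<Longrightarrow> j \<noteq> z \<Longrightarrow> (C *\<^sub>v a) $ j = 0"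
proof -
  \<comment> \<open>\<open>C + D\<close> is \<open>C\<close> with row \<open>z\<close> replaced by a unit vector; \<open>D\<close> has rank at most 1.\<close>
  define D where "D = mat n n (\<lambda>(i, j). of_bool (i = z) * (of_bool (j = z) - C $$ (z, j)))"
  have D: "D \<in> carrier_mat n n" by (simp add: D_def)
  have "vec_space.rank n D \<le> 1"
    by (rule vec_space.rank_le_1_product_entries[OF D, where f = "\<lambda>i. of_bool (i = z)"
          and g = "\<lambda>j. of_bool (j = z) - C $$ (z, j)"]) (simp add: D_def)
  then have "vec_space.rank n (C + D) < n" using vec_space.rank_subadditive[OF C D] rank by simp
  then have "det (C + D) = 0" using vec_space.det_rank_iff[of "C + D" n] C D by auto
  then obtain a where a: "a \<in> carrier_vec n" "a \<noteq> 0\<^sub>v n" "(C + D) *\<^sub>v a = 0\<^sub>v n"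
    using det_0_iff_vec_prod_zero[of "C + D" n] C D by auto
  have row: "row (C + D) j = (if j = z then unit_vec n z else row C j)" if "j < n" for j
    using that C z by (auto simp: D_def)
  have eq: "row (C + D) j \<bullet> a = 0" if "j < n" for j
    using arg_cong[OF a(3), of "\<lambda>w. w $ j"] that C D by simp
  have "a $ z = 0" using eq[OF z] z a(1) by (simp add: row)
  moreover have "(C *\<^sub>v a) $ j = 0" if "j < n" "j \<noteq> z" for j
    using eq[OF that(1)] that C by (simp add: row)
  ultimately show thesis using that a by blast
qed

text \<open>The nonorthogonal pairs listed form the path s - x - 0 - y - t. A relation without the
  term of vertex 0 is eliminated outwards along this path, first at \<open>x\<close> and
  \<open>y\<close>, then at \<open>s\<close> and \<open>t\<close>.\<close>

lemma not_cpsd_mat_pentagon: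
  assumes rank: "vec_space.rank 5 C = 3"
    and V: "{..<5} = {0, x, y, s, t}"
    and nonorth: "C $$ (0, x) \<noteq> 0" "C $$ (0, y) \<noteq> 0" "C $$ (x, s) \<noteq> 0" "C $$ (y, t) \<noteq> 0"
    and orth: "C $$ (0, s) = 0" "C $$ (0, t) = 0" "C $$ (x, y) = 0" "C $$ (x, t) = 0" "C $$ (y, s) = 0"
  shows "\<not> cpsd_mat 5 C"
proof
  assume "cpsd_mat 5 C"
  then obtain k P where C: "C \<in> carrier_mat 5 5" "transpose_mat C = C"
    and psd: "\<And>i. i < 5 \<Longrightarrow> psd_mat k (P i)"
    and tr: "\<And>i j. i < 5 \<Longrightarrow> j < 5 \<Longrightarrow> C $$ (i, j) = mat_trace (P i * P j)"
    unfolding cpsd_mat_def by blast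
  have lt: "0 < (5::nat)" "x < 5" "y < 5" "s < 5" "t < 5" using V by blast+
  obtain a where a: "a \<in> carrier_vec 5" "a \<noteq> 0\<^sub>v 5" "a $ 0 = 0"
    and ker: "\<And>j. j < 5 \<Longrightarrow> j \<noteq> 0 \<Longrightarrow> (C *\<^sub>v a) $ j = 0"
    using ex_almost_kernel_vec[OF C(1), of 0] rank by auto
  \<comment> \<open>The one row where the kernel equation may fail is row 0, and there
    \<open>a $ 0 = 0\<close>.\<close>
  have 0: "(\<Sum>i<5. a $ i * P i $$ (r, c)) = 0" if "r < k" "c < k" for r c
  proof (rule gram_kernel_lincomb[OF psd _ that])
    fix j :: nat assume j: "j < 5"
    have "(\<Sum>i<5. a $ i * mat_trace (P j * P i)) = (C *\<^sub>v a) $ j"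
      using C a(1) j by (auto simp: scalar_prod_def lessThan_atLeast0 tr mult.commute intro!: sum.cong)
    then show "a $ j = 0 \<or> (\<Sum>i<5. a $ i * mat_trace (P j * P i)) = 0"
      using ker[OF j] a(3) by (cases "j = 0") auto
  qed
  have coeff: "a $ e = 0"
    if "e < 5" "q < 5" "C $$ (e, q) \<noteq> 0"
      and others: "\<And>i. i \<in> {0, x, y, s, t} \<Longrightarrow> i \<noteq> e \<Longrightarrow> a $ i = 0 \<or> C $$ (e, i) = 0 \<or> C $$ (i, q) = 0"
    for e q
  proof (rule lincomb_coeff_eq_0[OF psd 0])
    fix i :: nat assume i: "i < 5" "i \<noteq> e"
    then have "i \<in> {0, x, y, s, t}" using V by blast
    from others[OF this i(2)] show "a $ i = 0 \<or> mat_trace (P e * P i) = 0 \<or> mat_trace (P i * P q) = 0"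
      using tr that(1,2) i(1) by simp
  qed (use that tr in auto)
  have sym: "C $$ (i, j) = C $$ (j, i)" if "i < 5" "j < 5" for i j
    using arg_cong[OF C(2), of "\<lambda>A. A $$ (i, j)"] C(1) that by simp
  have flip: "C $$ (x, 0) = C $$ (0, x)" "C $$ (y, 0) = C $$ (0, y)" "C $$ (s, 0) = C $$ (0, s)"
    "C $$ (t, 0) = C $$ (0, t)" "C $$ (y, x) = C $$ (x, y)" "C $$ (s, x) = C $$ (x, s)"
    "C $$ (t, x) = C $$ (x, t)" "C $$ (s, y) = C $$ (y, s)" "C $$ (t, y) = C $$ (y, t)"
    by (rule sym; rule lt)+
  \<comment> \<open>Each coefficient is isolated by taking for \<open>q\<close> the previous vertex
    on the path. The term of \<open>q\<close> is already known to be 0, and every other term is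
    killed by an orthogonality on the left or on the right.\<close>
  have ax: "a $ x = 0"
    by (rule coeff[of x 0]; (elim insertE emptyE)?; simp add: nonorth orth flip a(3) lt)
  have ay: "a $ y = 0"
    by (rule coeff[of y 0]; (elim insertE emptyE)?; simp add: nonorth orth flip a(3) lt)
  have as: "a $ s = 0"
    by (rule coeff[of s x]; (elim insertE emptyE)?; simp add: nonorth orth flip a(3) lt ax)
  have at: "a $ t = 0"
    by (rule coeff[of t y]; (elim insertE emptyE)?; simp add: nonorth orth flip a(3) lt ay)
  have "a $ i = 0" if "i < 5" for i
  proof -
    have "i \<in> {0, x, y, s, t}" using V that by blast
    then show ?thesis using a(3) ax ay as at by blast
  qed
  then have "a = 0\<^sub>v 5" using a(1) by (intro eq_vecI) auto
  with a(2) show False by contradiction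
qed

section \<open>Tensor products and orthogonality in a UPB\<close>

lemma sum_div_mod_lessThan:
  fixes g :: "nat \<Rightarrow> nat \<Rightarrow> 'a::comm_monoid_add"
  shows "(\<Sum>k<m * n. g (k div n) (k mod n)) = (\<Sum>i<m. \<Sum>j<n. g i j)"
proof -
  have less: "i * n + j < m * n" if "i < m" "j < n" for i j
  proof -
    have "i * n + j < Suc i * n" using that by simp
    also have "\<dots> \<le> m * n" using that by (intro mult_le_mono1) simp
    finally show ?thesis .
  qed
  have mod: "k mod n < n" if "k < m * n" for k using that by (cases "n = 0") auto
  have "(\<Sum>k<m * n. g (k div n) (k mod n)) = (\<Sum>(i, j)\<in>{..<m} \<times> {..<n}. g i j)"
    by (rule sum.reindex_bij_witness[of _ "\<lambda>(i, j). i * n + j" "\<lambda>k. (k div n, k mod n)"])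
       (auto simp: less less_mult_imp_div_less mod)
  then show ?thesis by (simp add: sum.cartesian_product)
qed

lemma tensor_vec_cscalar_prod:
  assumes "x \<in> carrier_vec d1" "a \<in> carrier_vec d1" "y \<in> carrier_vec d2" "b \<in> carrier_vec d2"
  shows "tensor_vec x y \<bullet>c tensor_vec a b = (x \<bullet>c a) * (y \<bullet>c b)"
proof -
  have mod: "k mod d2 < d2" if "k < d1 * d2" for k using that by (cases "d2 = 0") auto
  define g where "g = (\<lambda>i j. (x $ i * cnj (a $ i)) * (y $ j * cnj (b $ j)))"
  have "tensor_vec x y \<bullet>c tensor_vec a b = (\<Sum>k<d1 * d2. g (k div d2) (k mod d2))"
    using assms
    by (auto simp: g_def mod tensor_vec_def scalar_prod_def less_mult_imp_div_less lessThan_atLeast0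
        intro!: sum.cong)
  also have "\<dots> = (x \<bullet>c a) * (y \<bullet>c b)"
    unfolding sum_div_mod_lessThan using assms
    by (simp add: g_def scalar_prod_def sum_product lessThan_atLeast0)
  finally show ?thesis .
qed

lemma ex_orthogonal_to_two:
  fixes p q :: "complex vec"
  assumes "p \<in> carrier_vec 3" "q \<in> carrier_vec 3"
  obtains y where "y \<in> carrier_vec 3" "y \<noteq> 0\<^sub>v 3" "y \<bullet>c p = 0" "y \<bullet>c q = 0"
proof -
  \<comment> \<open>Repeating the row of \<open>q\<close> makes the matrix square and singular. The
    conjugates turn its bilinear row products into the sesquilinear
    \<open>\<bullet>c\<close>.\<close>
  define A where "A = mat_of_rows 3 [conjugate p, conjugate q, conjugate q]"
  have A: "A \<in> carrier_mat 3 3" by (intro carrier_matI) (simp_all add: A_def)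
  have rows: "row A 0 = conjugate p" "row A 1 = conjugate q" "row A 2 = conjugate q"
    using assms by (simp_all add: A_def mat_of_rows_row del: One_nat_def)
  have "det A = 0" by (rule det_identical_rows[OF A, of 1 2]) (simp_all add: rows del: One_nat_def)
  then obtain y where y: "y \<in> carrier_vec 3" "y \<noteq> 0\<^sub>v 3" "A *\<^sub>v y = 0\<^sub>v 3"
    using det_0_iff_vec_prod_zero[OF A] by auto
  have "row A i \<bullet> y = 0" if "i < 3" for i
    using arg_cong[OF y(3), of "\<lambda>w. w $ i"] that A by simp
  from this[of 0] this[of 1] show thesis
    using that[OF y(1,2)] assms y(1)
    by (simp add: rows comm_scalar_prod[of y 3] del: One_nat_def)
qed

text \<open>The extending product vector has \<open>u i\<close> itself as first factor and, as
  second, a vector orthogonal to \<open>v l\<close> and \<open>v m\<close> for the two indices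
  \<open>l\<close>, \<open>m\<close> outside \<open>J\<close>. The second claim swaps the roles of
  the factors.\<close>

lemma upb_not_orthogonal_to_three:
  assumes upb: "upb 3 3 5 u v" and i: "i < 5" and J: "J \<subseteq> {..<5}" "card J = 3"
  shows "\<exists>j\<in>J. u i \<bullet>c u j \<noteq> 0" "\<exists>j\<in>J. v i \<bullet>c v j \<noteq> 0"
proof -
  have u: "\<And>i. i < 5 \<Longrightarrow> u i \<in> carrier_vec 3" "u i \<noteq> 0\<^sub>v 3"
    and v: "\<And>i. i < 5 \<Longrightarrow> v i \<in> carrier_vec 3" "v i \<noteq> 0\<^sub>v 3"
    using upb i unfolding upb_def by blast+
  have unext: "\<exists>j<5. x \<bullet>c u j \<noteq> 0 \<and> y \<bullet>c v j \<noteq> 0"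
    if x: "x \<in> carrier_vec 3" "x \<noteq> 0\<^sub>v 3" and y: "y \<in> carrier_vec 3" "y \<noteq> 0\<^sub>v 3" for x y
  proof -
    \<comment> \<open>The inner product is the product of the squared norms of \<open>x\<close> and
      \<open>y\<close>, which shows that the tensor is nonzero.\<close>
    have "tensor_vec x y \<bullet>c tensor_vec x y \<noteq> 0"
      using x y by (simp add: tensor_vec_cscalar_prod[of _ 3 _ _ 3] conjugate_square_eq_0_vec[of _ 3])
    then have "tensor_vec x y \<noteq> 0\<^sub>v (3 * 3)"
      by (metis conjugate_square_eq_0_vec zero_carrier_vec)
    then obtain j where "j < 5" "tensor_vec x y \<bullet>c tensor_vec (u j) (v j) \<noteq> 0"
      using upb x(1) y(1) unfolding upb_def by blast
    then show ?thesis using u v x y by (auto simp: tensor_vec_cscalar_prod[of _ 3 _ _ 3])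
  qed
  have "card ({..<5} - J) = 2" using J by (simp add: card_Diff_subset finite_subset)
  then obtain l m where lm: "{..<5} - J = {l, m}" by (auto simp: card_2_iff)
  then have lt: "l < 5" "m < 5" by auto
  have J_if: "j \<in> J" if "j < 5" "j \<noteq> l" "j \<noteq> m" for j
    using lm that by blast
  obtain y where y: "y \<in> carrier_vec 3" "y \<noteq> 0\<^sub>v 3" "y \<bullet>c v l = 0" "y \<bullet>c v m = 0"
    using ex_orthogonal_to_two[OF v(1) v(1), OF lt] by blast
  show "\<exists>j\<in>J. u i \<bullet>c u j \<noteq> 0"
    using unext[OF u(1)[OF i] u(2) y(1,2)] y(3,4) J_if by metis
  obtain x where x: "x \<in> carrier_vec 3" "x \<noteq> 0\<^sub>v 3" "x \<bullet>c u l = 0" "x \<bullet>c u m = 0"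
    using ex_orthogonal_to_two[OF u(1) u(1), OF lt] by blast
  show "\<exists>j\<in>J. v i \<bullet>c v j \<noteq> 0"
    using unext[OF x(1,2) v(1)[OF i] v(2)] x(3,4) J_if by metis
qed

text \<open>Some \<open>v j\<close> with \<open>j\<close> in \<open>J\<close> is not orthogonal to
  \<open>v i\<close>, so the orthogonality of the product vectors must come from the
  \<open>u\<close> factor.\<close>

lemma upb_orthogonal_to_one_of_three:
  assumes upb: "upb 3 3 5 u v" and i: "i < 5" and J: "J \<subseteq> {..<5} - {i}" "card J = 3"
  shows "\<exists>j\<in>J. u i \<bullet>c u j = 0"
proof -
  obtain j where j: "j \<in> J" "v i \<bullet>c v j \<noteq> 0"
    using upb_not_orthogonal_to_three(2)[OF upb i _ J(2)] J(1) by blast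
  then have "j < 5" "i \<noteq> j" using J(1) by auto
  then have "tensor_vec (u i) (v i) \<bullet>c tensor_vec (u j) (v j) = 0"
    and "u i \<in> carrier_vec 3" "v i \<in> carrier_vec 3" "u j \<in> carrier_vec 3" "v j \<in> carrier_vec 3"
    using upb i unfolding upb_def by blast+
  then show ?thesis using j by (auto simp: tensor_vec_cscalar_prod[of _ 3 _ _ 3])
qed

section \<open>Recognizing the pentagon\<close>

text \<open>Among the four other vertices, at most two are neighbours and at most two are
  non-neighbours, so there are exactly two of each. The labels put the non-edges on the path s - x -
  0 - y - t.\<close>

lemma pentagon_vertex_labelling:
  fixes E :: "nat \<Rightarrow> nat \<Rightarrow> bool"
  assumes sym: "\<And>i j. i < 5 \<Longrightarrow> j < 5 \<Longrightarrow> E i j \<longleftrightarrow> E j i"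
    and E: "\<And>i J. i < 5 \<Longrightarrow> J \<subseteq> {..<5} - {i} \<Longrightarrow> card J = 3 \<Longrightarrow> \<exists>j\<in>J. \<not> E i j"
    and nE: "\<And>i J. i < 5 \<Longrightarrow> J \<subseteq> {..<5} - {i} \<Longrightarrow> card J = 3 \<Longrightarrow> \<exists>j\<in>J. E i j"
  obtains x y s t where "{..<5} = {0, x, y, s, t}" "\<not> E 0 x" "\<not> E 0 y" "\<not> E x s" "\<not> E y t"
    "E 0 s" "E 0 t" "E x y" "E x t" "E y s"
proof -
  have three: "(\<not> E i a \<or> \<not> E i b \<or> \<not> E i c) \<and> (E i a \<or> E i b \<or> E i c)"
    if "i < 5" "a < 5" "b < 5" "c < 5" "distinct [i, a, b, c]" for i a b c
  proof -
    have "{a, b, c} \<subseteq> {..<5} - {i}" "card {a, b, c} = 3" using that by simp_all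
    from E[OF that(1) this] nE[OF that(1) this] show ?thesis by simp
  qed
  define a b where "a = {j. j < 5 \<and> j \<noteq> 0 \<and> E 0 j}" and "b = {j. j < (5::nat) \<and> j \<noteq> 0 \<and> \<not> E 0 j}"
  have ab: "a \<union> b = {..<5} - {0}" "a \<inter> b = {}" "finite a" "finite b" by (auto simp: a_def b_def)
  then have "card a + card b = 4" using card_Un_disjoint[of a b] by simp
  moreover have "card a < 3"
  proof (rule ccontr)
    assume "\<not> card a < 3"
    then obtain J where "J \<subseteq> a" "card J = 3" by (meson not_less obtain_subset_with_card_n)
    then show False using E[of 0 J] by (auto simp: a_def)
  qed
  moreover have "card b < 3"
  proof (rule ccontr)
    assume "\<not> card b < 3"
    then obtain J where "J \<subseteq> b" "card J = 3" by (meson not_less obtain_subset_with_card_n)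
    then show False using nE[of 0 J] by (auto simp: b_def)
  qed
  ultimately have "card a = 2" "card b = 2" by auto
  then obtain s t x y where st: "a = {s, t}" "s \<noteq> t" and xy: "b = {x, y}" "x \<noteq> y"
    by (auto simp: card_2_iff)
  have 0: "E 0 s" "E 0 t" "\<not> E 0 x" "\<not> E 0 y"
    and lt: "s < 5" "t < 5" "x < 5" "y < 5" "(0::nat) < 5"
    and ne: "s \<noteq> 0" "t \<noteq> 0" "x \<noteq> 0" "y \<noteq> 0"
    using st(1) xy(1) by (auto simp: a_def b_def)
  have ne2: "s \<noteq> x" "s \<noteq> y" "t \<noteq> x" "t \<noteq> y" using 0 by auto
  have "{..<5} = insert 0 (a \<union> b)" unfolding ab(1) by auto
  then have V: "{..<5} = {0, x, y, s, t}" unfolding st(1) xy(1) by blast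
  have sym': "E x 0 \<longleftrightarrow> E 0 x" "E y 0 \<longleftrightarrow> E 0 y" "E s 0 \<longleftrightarrow> E 0 s" "E t 0 \<longleftrightarrow> E 0 t"
    "E y x \<longleftrightarrow> E x y" "E s x \<longleftrightarrow> E x s" "E t x \<longleftrightarrow> E x t" "E s y \<longleftrightarrow> E y s" "E t y \<longleftrightarrow> E y t"
    "E t s \<longleftrightarrow> E s t" by (rule sym; use lt in simp)+
  \<comment> \<open>If \<open>x\<close> and \<open>y\<close> were not adjacent, each would be
    adjacent to both \<open>s\<close> and \<open>t\<close>, giving \<open>s\<close> the three
    neighbours 0, \<open>x\<close>, \<open>y\<close>. Hence each of \<open>x\<close>,
    \<open>y\<close> has exactly one neighbour among \<open>s\<close>, \<open>t\<close>, and these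
    differ for the same reason. The two outcomes are exchanged by swapping \<open>s\<close> and
    \<open>t\<close>.\<close>
  have "E x y \<and> (\<not> E x s \<and> E x t \<and> E y s \<and> \<not> E y t \<or> E x s \<and> \<not> E x t \<and> \<not> E y s \<and> E y t)"
    using three[OF lt(3,5,1,4)] three[OF lt(3,5,2,4)] three[OF lt(3,5,1,2)] three[OF lt(3,1,2,4)]
      three[OF lt(4,5,1,3)] three[OF lt(4,5,2,3)] three[OF lt(4,5,1,2)] three[OF lt(4,1,2,3)]
      three[OF lt(1,5,3,4)] three[OF lt(2,5,3,4)] 0 ne ne2 st(2) xy(2) sym'
    by (simp add: ne[symmetric] ne2[symmetric] st(2)[symmetric] xy(2)[symmetric]) blast
  then show thesis
  proof (elim conjE disjE)
    assume "E x y" "\<not> E x s" "E x t" "E y s" "\<not> E y t"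
    then show thesis using that[OF V] 0 by blast
  next
    assume "E x y" "E x s" "\<not> E x t" "\<not> E y s" "E y t"
    moreover have "{..<5} = {0, x, y, t, s}" using V by auto
    ultimately show thesis using that[of x y t s] 0 by blast
  qed
qed

section \<open>Transfer along the graph isomorphism\<close>

lemma digraph_iso_orth_graphsE:
  assumes "digraph_iso (with_proj (mat_orth_graph N C)) (with_proj (upb_orth_graph m u))"
  obtains f where "N = m" "bij_betw f {..<N} {..<N}"
    "\<And>i j. i < N \<Longrightarrow> j < N \<Longrightarrow> i \<noteq> j \<Longrightarrow> C $$ (i, j) = 0 \<longleftrightarrow> u (f i) \<bullet>c u (f j) = 0"
proof -
  let ?G = "with_proj (mat_orth_graph N C)" and ?H = "with_proj (upb_orth_graph m u)"
  obtain h where h: "pre_digraph.digraph_isomorphism ?G h" and H: "?H = app_iso h ?G"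
    using assms by (auto simp: digraph_iso_def)
  define f where "f = iso_verts h"
  have inj: "inj_on f {..<N}"
    using h by (simp add: pre_digraph.digraph_isomorphism_def f_def mat_orth_graph_def)
  have "verts ?H = f ` {..<N}" by (subst H) (simp add: f_def mat_orth_graph_def)
  then have img: "{..<m} = f ` {..<N}" by (simp add: upb_orth_graph_def)
  then have N: "N = m" using card_image[OF inj] by (metis card_lessThan)
  \<comment> \<open>The isomorphism \<open>h\<close> carries its own arc map and end maps. Since
    \<open>app_iso h\<close> installs \<open>iso_tail h\<close> and \<open>iso_head h\<close> as the
    projections of \<open>?H\<close>, they are \<open>fst\<close> and \<open>snd\<close>, so the arc
    map is induced by the vertex map \<open>f\<close>.\<close>
  have ends: "iso_arcs h e = (f (fst e), f (snd e))" if "e \<in> arcs ?G" for e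
  proof -
    have "iso_tail h = fst" "iso_head h = snd"
      using arg_cong[OF H, of tail] arg_cong[OF H, of head] by simp_all
    then show ?thesis
      using h that by (simp add: pre_digraph.digraph_isomorphism_def f_def prod_eq_iff)
  qed
  have "parcs (upb_orth_graph m u) = iso_arcs h ` arcs ?G"
    using arg_cong[OF H, of arcs] by simp
  also have "\<dots> = (\<lambda>e. (f (fst e), f (snd e))) ` arcs ?G"
    by (rule image_cong[OF refl ends])
  finally have arcs: "parcs (upb_orth_graph m u) = (\<lambda>e. (f (fst e), f (snd e))) ` parcs (mat_orth_graph N C)"
    by simp
  have "C $$ (i, j) = 0 \<longleftrightarrow> u (f i) \<bullet>c u (f j) = 0" if ij: "i < N" "j < N" "i \<noteq> j" for i j
  proof -
    have "C $$ (i, j) = 0 \<longleftrightarrow> (i, j) \<in> parcs (mat_orth_graph N C)"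
      using ij by (simp add: mat_orth_graph_def)
    also have "\<dots> \<longleftrightarrow> (f i, f j) \<in> parcs (upb_orth_graph m u)"
      unfolding arcs using ij by (auto simp: mat_orth_graph_def image_iff inj_on_eq_iff[OF inj])
    also have "\<dots> \<longleftrightarrow> u (f i) \<bullet>c u (f j) = 0"
      using ij inj img by (auto simp: upb_orth_graph_def dest: inj_onD)
    finally show ?thesis .
  qed
  moreover have "bij_betw f {..<N} {..<N}" using img[symmetric] inj N by (simp add: bij_betw_def)
  ultimately show thesis using that N by blast
qed

text \<open>The two bounds on orthogonality within \<open>u\<close> pull back along
  \<open>f\<close>, because \<open>f\<close> sends three vertices other than \<open>i\<close> to
  three vertices other than \<open>f i\<close>. Symmetry of the relation comes from that of
  \<open>C\<close>.\<close>

lemma orth_graph_upb_pentagon: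
  assumes transpose: "C \<in> carrier_mat N N" "transpose_mat C = C"
    and upb: "upb 3 3 5 u v"
    and iso: "digraph_iso (with_proj (mat_orth_graph N C)) (with_proj (upb_orth_graph 5 u))"
  obtains x y s t where "N = 5" "{..<5} = {0, x, y, s, t}"
    "C $$ (0, x) \<noteq> 0" "C $$ (0, y) \<noteq> 0" "C $$ (x, s) \<noteq> 0" "C $$ (y, t) \<noteq> 0"
    "C $$ (0, s) = 0" "C $$ (0, t) = 0" "C $$ (x, y) = 0" "C $$ (x, t) = 0" "C $$ (y, s) = 0"
proof -
  obtain f where N: "N = 5" and bij: "bij_betw f {..<N} {..<N}"
    and orthN: "\<And>i j. i < N \<Longrightarrow> j < N \<Longrightarrow> i \<noteq> j \<Longrightarrow> C $$ (i, j) = 0 \<longleftrightarrow> u (f i) \<bullet>c u (f j) = 0"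
    using digraph_iso_orth_graphsE[OF iso] by blast
  have f: "bij_betw f {..<5} {..<5}" using bij N by simp
  have orth: "C $$ (i, j) = 0 \<longleftrightarrow> u (f i) \<bullet>c u (f j) = 0" if "i < 5" "j < 5" "i \<noteq> j" for i j
    using orthN that N by simp
  have f_lt: "f i < 5" if "i < 5" for i using bij_betwE[OF f] that by auto
  have sym: "C $$ (i, j) = C $$ (j, i)" if "i < 5" "j < 5" for i j
    using arg_cong[OF transpose(2), of "\<lambda>A. A $$ (i, j)"] transpose(1) that by (simp add: N)
  have fJ: "f ` J \<subseteq> {..<5} - {f i}" "card (f ` J) = 3"
    if "i < 5" "J \<subseteq> {..<5} - {i}" "card J = 3" for i J
  proof -
    have inj: "inj_on f {..<5}" using f by (rule bij_betw_imp_inj_on)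
    show "f ` J \<subseteq> {..<5} - {f i}" using that f_lt inj_on_eq_iff[OF inj] by (auto simp: subset_iff)
    show "card (f ` J) = 3" using that card_image[OF inj_on_subset[OF inj, of J]] by auto
  qed
  show thesis
  proof (rule pentagon_vertex_labelling[of "\<lambda>i j. C $$ (i, j) = 0"])
    fix i and J :: "nat set"
    assume iJ: "i < 5" "J \<subseteq> {..<5} - {i}" "card J = 3"
    have *: "C $$ (i, j) = 0 \<longleftrightarrow> u (f i) \<bullet>c u (f j) = 0" if "j \<in> J" for j
      using orth iJ that by blast
    show "\<exists>j\<in>J. C $$ (i, j) \<noteq> 0"
      using upb_not_orthogonal_to_three(1)[OF upb f_lt[OF iJ(1)] _ fJ(2)[OF iJ]] fJ(1)[OF iJ] *
      by blast
    show "\<exists>j\<in>J. C $$ (i, j) = 0"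
      using upb_orthogonal_to_one_of_three[OF upb f_lt[OF iJ(1)] fJ[OF iJ]] * by blast
  next
    fix i j :: nat assume "i < 5" "j < 5"
    then show "C $$ (i, j) = 0 \<longleftrightarrow> C $$ (j, i) = 0" using sym[of i j] by simp
  qed (rule that[OF N])
qed

theorem theorem6p13:
  fixes C :: "complex mat" and N :: nat
    and u v :: "nat \<Rightarrow> complex vec"
  assumes "correlation_mat N C"
    and "vec_space.rank N C = 3"
    and "upb 3 3 5 u v"
    and "digraph_iso (with_proj (mat_orth_graph N C)) (with_proj (upb_orth_graph 5 u))"
  shows "\<not> cpsd_mat N C"
proof
  assume cpsd: "cpsd_mat N C"
  then have "C \<in> carrier_mat N N" "transpose_mat C = C" by (simp_all add: cpsd_mat_def)
  then obtain x y s t where "N = 5" "{..<5} = {0, x, y, s, t}"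
    "C $$ (0, x) \<noteq> 0" "C $$ (0, y) \<noteq> 0" "C $$ (x, s) \<noteq> 0" "C $$ (y, t) \<noteq> 0"
    "C $$ (0, s) = 0" "C $$ (0, t) = 0" "C $$ (x, y) = 0" "C $$ (x, t) = 0" "C $$ (y, s) = 0"
    using orth_graph_upb_pentagon[OF _ _ assms(3,4)] by metis
  with not_cpsd_mat_pentagon assms(2) cpsd show False by blast
qed

end
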